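(* Let $G$ be a non-bipartite graph and let $i,n,s$ be positive integers with $is=n-1$. Then $$\chi_n\big(G^{\frac{1}{2s+1}}\big)\le 2n+i \iff \chi(G)\le \binom{2n+i}{n}.$$
   Context: For positive integers $m\ge 2n$, the Kneser graph $\mathrm{KG}(m,n)$ has as vertices the $n$-subsets of $\{1,\dots,m\}$, two being adjacent iff they are disjoint. The $n$th multichromatic number $\chi_n(H)$ of a graph $H$ is the smallest $m$ such that $H$ admits a homomorphism to $\mathrm{KG}(m,n)$, i.e. an assignment of $n$-subsets of $\{1,\dots,m\}$ to vertices with adjacent vertices receiving disjoint sets. $\chi(G)$ is the chromatic number. For a positive integer $t$, $G^{1/t}$ is the graph obtained from $G$ by replacing each edge by a path with $t$ edges. *)

theory Defs
  imports "Graph_Theory.Graph_Theory" "HOL-Library.Extended_Nat" "HOL-Library.FuncSet"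
begin

text \<open>
  A simple undirected graph, finite or infinite, is a \<^typ>\<open>'a pair_pre_digraph\<close> satisfying
  \<^const>\<open>pair_bidirected_digraph\<close>: well-formed, loop-free, and with a symmetric arc relation.
\<close>

definition graph_hom :: "'a pair_pre_digraph \<Rightarrow> 'b pair_pre_digraph \<Rightarrow> ('a \<Rightarrow> 'b) \<Rightarrow> bool" where
  "graph_hom G H f \<longleftrightarrow>
     f \<in> pverts G \<rightarrow> pverts H \<and> (\<forall>(u, v) \<in> parcs G. (f u, f v) \<in> parcs H)"

definition bipartite :: "'a pair_pre_digraph \<Rightarrow> bool" where
  "bipartite G \<longleftrightarrow>
     (\<exists>A B. A \<union> B = pverts G \<and> A \<inter> B = {} \<and> parcs G \<subseteq> (A \<times> B) \<union> (B \<times> A))"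

definition proper_colouring :: "'a pair_pre_digraph \<Rightarrow> nat \<Rightarrow> ('a \<Rightarrow> nat) \<Rightarrow> bool" where
  "proper_colouring G k c \<longleftrightarrow>
     c \<in> pverts G \<rightarrow> {1..k} \<and> (\<forall>(u, v) \<in> parcs G. c u \<noteq> c v)"

text \<open>
  An infimum in \<^typ>\<open>enat\<close> is the least element of the set if the set is nonempty, and
  \<^term>\<open>\<infinity> :: enat\<close> otherwise (which can happen for infinite graphs).
\<close>

definition chromatic_number :: "'a pair_pre_digraph \<Rightarrow> enat" where
  "chromatic_number G = (INF k \<in> {k. \<exists>c. proper_colouring G k c}. enat k)"

definition kneser_graph :: "nat \<Rightarrow> nat \<Rightarrow> nat set pair_pre_digraph" where
  "kneser_graph m n =
     \<lparr> pverts = {A. A \<subseteq> {1..m} \<and> card A = n},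
       parcs = {(A, B). A \<subseteq> {1..m} \<and> card A = n \<and> B \<subseteq> {1..m} \<and> card B = n \<and> A \<inter> B = {}} \<rparr>"

text \<open>
  The bound \<^prop>\<open>2 * n \<le> m\<close> is the range of parameters for which Kneser graphs are considered;
  it matters only for graphs without arcs.
\<close>

definition multichromatic_number :: "nat \<Rightarrow> 'a pair_pre_digraph \<Rightarrow> enat" where
  "multichromatic_number n H =
     (INF m \<in> {m. 2 * n \<le> m \<and> (\<exists>f. graph_hom H (kneser_graph m n) f)}. enat m)"

text \<open>
  \<open>path_point t u v k\<close> is the vertex at distance \<open>k\<close> from \<open>u\<close> on the path with \<open>t\<close> edges that
  replaces the edge \<open>uv\<close>. An inner vertex is represented by both of its descriptions, at distance
  \<open>k\<close> from \<open>u\<close> and at distance \<open>t - k\<close> from \<open>v\<close>, so that the arcs \<open>(u, v)\<close> and \<open>(v, u)\<close> give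
  the same path.
\<close>

definition path_point :: "nat \<Rightarrow> 'a \<Rightarrow> 'a \<Rightarrow> nat \<Rightarrow> 'a + ('a \<times> 'a \<times> nat) set" where
  "path_point t u v k =
     (if k = 0 then Inl u else if k = t then Inl v else Inr {(u, v, k), (v, u, t - k)})"

text \<open>
  The graph \<open>G\<^sup>1\<^sup>/\<^sup>t\<close> for \<open>t > 0\<close>. Its arc relation is symmetric for symmetric \<open>G\<close>, since the steps
  of the path of \<open>(v, u)\<close> are the reversed steps of the path of \<open>(u, v)\<close>.
\<close>

definition subdivided_graph ::
  "nat \<Rightarrow> 'a pair_pre_digraph \<Rightarrow> ('a + ('a \<times> 'a \<times> nat) set) pair_pre_digraph" where
  "subdivided_graph t G =
     \<lparr> pverts = Inl ` pverts G \<union> {path_point t u v k | u v k. (u, v) \<in> parcs G \<and> k \<le> t},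
       parcs = {(path_point t u v k, path_point t u v (Suc k)) | u v k.
                  (u, v) \<in> parcs G \<and> k < t} \<rparr>"

lemma path_point_swap:
  assumes "0 < t" "k \<le> t"
  shows "path_point t v u (t - k) = path_point t u v k"
  using assms by (auto simp: path_point_def insert_commute)

lemma path_point_eq_inner_iff:
  assumes "0 < k" "k < t" "l \<le> t"
  shows "path_point t u v k = path_point t x y l \<longleftrightarrow>
    x = u \<and> y = v \<and> l = k \<or> x = v \<and> y = u \<and> l = t - k"
  using assms by (auto simp: path_point_def doubleton_eq_iff)

lemma path_point_neq_Suc:
  assumes "u \<noteq> v" "k < t"
  shows "path_point t u v k \<noteq> path_point t u v (Suc k)"
  using assms by (auto simp: path_point_def doubleton_eq_iff)

lemma mem_parcs_subdivided_graph_iff: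
  "(p, q) \<in> parcs (subdivided_graph t G) \<longleftrightarrow>
     (\<exists>u v k. (u, v) \<in> parcs G \<and> k < t \<and> p = path_point t u v k \<and> q = path_point t u v (Suc k))"
  unfolding subdivided_graph_def by auto

lemma path_point_mem_pverts:
  "(u, v) \<in> parcs G \<Longrightarrow> k \<le> t \<Longrightarrow> path_point t u v k \<in> pverts (subdivided_graph t G)"
  unfolding subdivided_graph_def by auto

lemma pair_bidirected_digraph_subdivided_graph:
  assumes G: "pair_bidirected_digraph G" and t: "0 < t"
  shows "pair_bidirected_digraph (subdivided_graph t G)"
proof -
  interpret pair_bidirected_digraph G by (fact G)
  have parcs_sym: "(v, u) \<in> parcs G" if "(u, v) \<in> parcs G" for u v
    using that pair_sym_arcs unfolding symmetric_def sym_def by simp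
  let ?H = "subdivided_graph t G"
  have fst_in: "fst e \<in> pverts ?H" and snd_in: "snd e \<in> pverts ?H" and neq: "fst e \<noteq> snd e"
    if "e \<in> parcs ?H" for e
  proof -
    obtain p q where pq: "e = (p, q)" by (cases e)
    with that obtain u v k where e: "(u, v) \<in> parcs G" "k < t"
      "p = path_point t u v k" "q = path_point t u v (Suc k)"
      using mem_parcs_subdivided_graph_iff by metis
    show "fst e \<in> pverts ?H" "snd e \<in> pverts ?H"
      unfolding pq e(3,4) fst_conv snd_conv by (rule path_point_mem_pverts; use e(1,2) in simp)+
    have "u \<noteq> v" using pair_no_loops[OF e(1)] by simp
    then show "fst e \<noteq> snd e"
      unfolding pq e(3,4) fst_conv snd_conv using e(2) by (rule path_point_neq_Suc)
  qed
  have "(q, p) \<in> parcs ?H" if "(p, q) \<in> parcs ?H" for p q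
  proof -
    from that obtain u v k where e: "(u, v) \<in> parcs G" "k < t"
      "p = path_point t u v k" "q = path_point t u v (Suc k)"
      unfolding mem_parcs_subdivided_graph_iff by blast
    have "q = path_point t v u (t - Suc k)"
      unfolding e(4) using path_point_swap[of t "Suc k" v u] e(2) by simp
    moreover have "p = path_point t v u (Suc (t - Suc k))"
      unfolding e(3) Suc_diff_Suc[OF e(2)] using path_point_swap[of t k v u] e(2) by simp
    moreover have "t - Suc k < t" using t by simp
    ultimately show ?thesis
      unfolding mem_parcs_subdivided_graph_iff using parcs_sym[OF e(1)] by blast
  qed
  then have sym: "symmetric ?H" unfolding symmetric_def sym_def by simp
  have "pair_wf_digraph ?H"
    by (rule pair_wf_digraph.intro) (fact fst_in, fact snd_in)
  moreover from this have "pair_sym_digraph ?H"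
    by (rule pair_sym_digraph.intro) (rule pair_sym_digraph_axioms.intro, fact sym)
  moreover from \<open>pair_wf_digraph ?H\<close> have "pair_loopfree_digraph ?H"
    by (rule pair_loopfree_digraph.intro) (rule pair_loopfree_digraph_axioms.intro, fact neq)
  ultimately show ?thesis
    by (intro pair_bidirected_digraph.intro)
qed

lemma pair_bidirected_digraph_kneser_graph:
  assumes "0 < n"
  shows "pair_bidirected_digraph (kneser_graph m n)"
proof -
  have wf: "pair_wf_digraph (kneser_graph m n)"
    by (rule pair_wf_digraph.intro) (auto simp: kneser_graph_def)
  have sym: "symmetric (kneser_graph m n)"
    unfolding symmetric_def sym_def by (auto simp: kneser_graph_def)
  have neq: "fst e \<noteq> snd e" if "e \<in> parcs (kneser_graph m n)" for e
  proof
    assume "fst e = snd e"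
    moreover have "fst e \<inter> snd e = {}" "card (fst e) = n"
      using that unfolding kneser_graph_def by auto
    ultimately have "card {} = n" by simp
    with assms show False by simp
  qed
  have "pair_sym_digraph (kneser_graph m n)"
    by (rule pair_sym_digraph.intro[OF wf]) (rule pair_sym_digraph_axioms.intro, fact sym)
  moreover have "pair_loopfree_digraph (kneser_graph m n)"
    by (rule pair_loopfree_digraph.intro[OF wf]) (rule pair_loopfree_digraph_axioms.intro, fact neq)
  ultimately show ?thesis
    by (rule pair_bidirected_digraph.intro)
qed

end

(* A homomorphism from G^(1/t) to H is a map on the vertices of G that sends adjacent vertices to
   the ends of a walk of length t in H.  For H = KG(2n+i, n) two n-sets have a common neighbour iff
   they differ in at most i elements, so 2s steps exchange at most i*s elements.  If i*s = n - 1,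
   then an n-set A reaches by such a walk exactly the n-sets that meet it; hence a walk of length
   2s + 1 joins A to precisely the n-sets other than A, and the (2s+1)-walk relation is that of the
   complete graph on all n-sets. *)
theory Submission
  imports Defs
begin

section \<open>Bounds on the two chromatic numbers as existence of maps\<close>

lemma INF_enat_le_iff:
  fixes S :: "nat set"
  shows "(INF k \<in> S. enat k) \<le> enat N \<longleftrightarrow> (\<exists>k \<in> S. k \<le> N)"
proof
  assume le: "(INF k \<in> S. enat k) \<le> enat N"
  \<comment> \<open>The empty infimum is \<infinity>, which exceeds every \<open>enat N\<close>;
    over a nonempty set the infimum is attained.\<close>
  then have "S \<noteq> {}" by (auto simp: top_enat_def)
  then have "(INF k \<in> S. enat k) \<in> enat ` S"
    by (auto simp: Inf_enat_def intro: LeastI)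
  with le show "\<exists>k \<in> S. k \<le> N" by auto
next
  assume "\<exists>k \<in> S. k \<le> N"
  then obtain k where "k \<in> S" "k \<le> N" by blast
  then show "(INF k \<in> S. enat k) \<le> enat N"
    by (meson INF_lower2 enat_ord_simps(1))
qed

lemma chromatic_number_le_iff:
  "chromatic_number G \<le> enat N \<longleftrightarrow> (\<exists>c. proper_colouring G N c)"
proof -
  have "proper_colouring G N c" if "proper_colouring G k c" "k \<le> N" for c k
    using that by (fastforce simp: proper_colouring_def Pi_iff)
  then show ?thesis unfolding chromatic_number_def INF_enat_le_iff by blast
qed

text \<open>A homomorphism to a smaller Kneser graph with the same \<open>n\<close> is one to the
  larger, which contains it as a subgraph. The assumption makes \<open>N\<close> itself an
  admissible value in the infimum.\<close>

lemma multichromatic_number_le_iff: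
  assumes "2 * n \<le> N"
  shows "multichromatic_number n H \<le> enat N \<longleftrightarrow> (\<exists>f. graph_hom H (kneser_graph N n) f)"
proof -
  have "graph_hom H (kneser_graph N n) f" if "graph_hom H (kneser_graph m n) f" "m \<le> N" for f m
  proof -
    have "{1..m} \<subseteq> {1..N}" using that(2) by auto
    with that(1) show ?thesis
      unfolding graph_hom_def kneser_graph_def by (fastforce simp: Pi_iff)
  qed
  with assms show ?thesis unfolding multichromatic_number_def INF_enat_le_iff by blast
qed

text \<open>Colours are renamed along a bijection between \<open>{1..card S}\<close> and
  \<open>S\<close>, so that the vertices of a Kneser graph can themselves serve as colours.\<close>

lemma proper_colouring_iff_distinguishing_map:
  assumes wf: "pair_wf_digraph G" and fin: "finite S"
  shows "(\<exists>c. proper_colouring G (card S) c) \<longleftrightarrow>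
    (\<exists>g \<in> funcset (pverts G) S. \<forall>(u, v) \<in> parcs G. g u \<noteq> g v)"
    (is "?L \<longleftrightarrow> ?R")
proof -
  have ends: "u \<in> pverts G" "v \<in> pverts G" if "(u, v) \<in> parcs G" for u v
    using pair_wf_digraph.in_arcsD1[OF wf that] pair_wf_digraph.in_arcsD2[OF wf that] .
  obtain h where h: "bij_betw h {1..card S} S"
    using fin ex_bij_betw_nat_finite_1 by blast
  let ?h' = "inv_into {1..card S} h"
  have h': "bij_betw ?h' S {1..card S}" using h by (rule bij_betw_inv_into)
  show ?thesis
  proof
    assume ?L
    then obtain c where c: "c \<in> funcset (pverts G) {1..card S}" "\<forall>(u, v) \<in> parcs G. c u \<noteq> c v"
      unfolding proper_colouring_def by blast
    have "h \<circ> c \<in> funcset (pverts G) S" using c(1) bij_betwE[OF h] by auto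
    moreover have "(h \<circ> c) u \<noteq> (h \<circ> c) v" if "(u, v) \<in> parcs G" for u v
      using that c ends[OF that] inj_onD[OF bij_betw_imp_inj_on[OF h]] by (fastforce simp: Pi_iff)
    ultimately show ?R by blast
  next
    assume ?R
    then obtain g where g: "g \<in> funcset (pverts G) S" "\<forall>(u, v) \<in> parcs G. g u \<noteq> g v" by blast
    have "?h' \<circ> g \<in> funcset (pverts G) {1..card S}" using g(1) bij_betwE[OF h'] by auto
    moreover have "(?h' \<circ> g) u \<noteq> (?h' \<circ> g) v" if "(u, v) \<in> parcs G" for u v
      using that g ends[OF that] inj_onD[OF bij_betw_imp_inj_on[OF h']] by (fastforce simp: Pi_iff)
    ultimately show ?L unfolding proper_colouring_def by blast
  qed
qed

section \<open>Homomorphisms from subdivisions\<close>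

lemma graph_hom_subdivided_walk:
  assumes f: "graph_hom (subdivided_graph t G) H f" and uv: "(u, v) \<in> parcs G" and t: "0 < t"
  shows "(f (Inl u), f (Inl v)) \<in> parcs H ^^ t"
proof -
  let ?w = "\<lambda>k. f (path_point t u v k)"
  have "(?w k, ?w (Suc k)) \<in> parcs H" if "k < t" for k
  proof -
    have "(path_point t u v k, path_point t u v (Suc k)) \<in> parcs (subdivided_graph t G)"
      using uv that unfolding mem_parcs_subdivided_graph_iff by blast
    with f show ?thesis unfolding graph_hom_def by blast
  qed
  moreover have "?w 0 = f (Inl u)" "?w t = f (Inl v)"
    using t by (simp_all add: path_point_def)
  ultimately show ?thesis unfolding relpow_fun_conv by (intro exI[of _ ?w]) blast
qed

text \<open>The given walks become the images of the paths that replace the edges. The work lies in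
  well-definedness, since the paths of \<open>(u, v)\<close> and \<open>(v, u)\<close> share their
  inner vertices.\<close>

lemma graph_hom_subdividedI:
  assumes G: "pair_bidirected_digraph G" and H: "pair_bidirected_digraph H" and t: "0 < t"
    and g: "g \<in> funcset (pverts G) (pverts H)"
    and walk: "\<And>u v. (u, v) \<in> parcs G \<Longrightarrow> (g u, g v) \<in> parcs H ^^ t"
  shows "\<exists>f. graph_hom (subdivided_graph t G) H f"
proof -
  interpret G: pair_bidirected_digraph G by (fact G)
  interpret H: pair_bidirected_digraph H by (fact H)
  have symG: "(v, u) \<in> parcs G" if "(u, v) \<in> parcs G" for u v
    using that G.pair_sym_arcs unfolding symmetric_def sym_def by simp
  have symH: "(B, A) \<in> parcs H" if "(A, B) \<in> parcs H" for A B
    using that H.pair_sym_arcs unfolding symmetric_def sym_def by simp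
  have "\<exists>w. (u, v) \<in> parcs G \<longrightarrow>
      w 0 = g u \<and> w t = g v \<and> (\<forall>k<t. (w k, w (Suc k)) \<in> parcs H)" for u v
    using walk[of u v] unfolding relpow_fun_conv by blast
  then obtain w where w: "(u, v) \<in> parcs G \<Longrightarrow> w u v 0 = g u" "(u, v) \<in> parcs G \<Longrightarrow> w u v t = g v"
    "(u, v) \<in> parcs G \<Longrightarrow> k < t \<Longrightarrow> (w u v k, w u v (Suc k)) \<in> parcs H" for u v k
    by metis
  \<comment> \<open>The walks chosen for \<open>(u, v)\<close> and \<open>(v, u)\<close> need not be reverse to each other, so each edge
    gets an orientation \<open>e {u, v}\<close> and only the walk of that orientation is used.\<close>
  define e where "e S = (SOME (x, y). {x, y} = S)" for S :: "'a set"
  have e: "e {u, v} = (u, v) \<or> e {u, v} = (v, u)" for u v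
  proof -
    have "case e {u, v} of (x, y) \<Rightarrow> {x, y} = {u, v}"
      unfolding e_def by (rule someI[of _ "(u, v)"]) simp
    then show ?thesis by (auto simp: doubleton_eq_iff split: prod.splits)
  qed
  define w' where "w' u v k = (if e {u, v} = (u, v) then w u v k else w v u (t - k))" for u v k
  have w'0: "w' u v 0 = g u" and w't: "w' u v t = g v"
    if "(u, v) \<in> parcs G" for u v
    using that symG[OF that] w unfolding w'_def by auto
  have w'_step: "(w' u v k, w' u v (Suc k)) \<in> parcs H" if "(u, v) \<in> parcs G" "k < t" for u v k
  proof (cases "e {u, v} = (u, v)")
    case True
    with that w(3) show ?thesis unfolding w'_def by simp
  next
    case False
    \<comment> \<open>Against the orientation, step \<open>k\<close> is step
      \<open>t - Suc k\<close> of the chosen walk run backwards; symmetry of \<open>H\<close>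
      reverses the arc.\<close>
    have "(w v u (t - Suc k), w v u (Suc (t - Suc k))) \<in> parcs H"
      using symG[OF that(1)] that(2) w(3) by simp
    with False that(2) show ?thesis unfolding w'_def by (simp add: symH Suc_diff_Suc)
  qed
  have w'_swap: "w' v u (t - k) = w' u v k" if "(u, v) \<in> parcs G" "k \<le> t" for u v k
  proof -
    \<comment> \<open>Loop-freeness matters here: on a loop the chosen walk would have to equal its
      own reversal.\<close>
    have "u \<noteq> v" using G.pair_no_loops[OF that(1)] by simp
    with e[of u v] that(2) show ?thesis unfolding w'_def by (auto simp: insert_commute)
  qed
  \<comment> \<open>An inner vertex is evaluated at an arbitrary one of its two descriptions;
    \<open>w'_swap\<close> makes the choice immaterial.\<close>
  define f where "f p = (case p of Inl u \<Rightarrow> g u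
      | Inr S \<Rightarrow> (case SOME x. x \<in> S of (u, v, k) \<Rightarrow> w' u v k))"
    for p :: "'a + ('a \<times> 'a \<times> nat) set"
  have f_path: "f (path_point t u v k) = w' u v k" if "(u, v) \<in> parcs G" "k \<le> t" for u v k
  proof (cases "k = 0 \<or> k = t")
    case True
    with w'0[OF that(1)] w't[OF that(1)] show ?thesis by (auto simp: f_def path_point_def)
  next
    case False
    let ?S = "{(u, v, k), (v, u, t - k)}"
    have "(SOME x. x \<in> ?S) \<in> ?S" by (rule someI[of _ "(u, v, k)"]) simp
    with w'_swap[OF that] have "(case SOME x. x \<in> ?S of (u, v, k) \<Rightarrow> w' u v k) = w' u v k"
      by auto
    with False show ?thesis by (simp add: f_def path_point_def)
  qed
  have w'_in: "w' u v k \<in> pverts H" if "(u, v) \<in> parcs G" "k \<le> t" for u v k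
  proof (cases "k = t")
    case True
    have "v \<in> pverts G" using that(1) G.in_arcsD2 by blast
    with g True w't[OF that(1)] show ?thesis by auto
  next
    case False
    with that have "(w' u v k, w' u v (Suc k)) \<in> parcs H" by (intro w'_step) auto
    then show ?thesis using H.in_arcsD1 by blast
  qed
  have "f p \<in> pverts H" if "p \<in> pverts (subdivided_graph t G)" for p
  proof -
    from that consider u where "p = Inl u" "u \<in> pverts G"
      | u v k where "p = path_point t u v k" "(u, v) \<in> parcs G" "k \<le> t"
      unfolding subdivided_graph_def by auto
    then show ?thesis
    proof cases
      case 1
      with g show ?thesis by (auto simp: f_def)
    next
      case 2
      with f_path w'_in show ?thesis by simp
    qed
  qed
  moreover have "(f p, f q) \<in> parcs H" if "(p, q) \<in> parcs (subdivided_graph t G)" for p q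
  proof -
    from that obtain u v k where "(u, v) \<in> parcs G" "k < t"
      "p = path_point t u v k" "q = path_point t u v (Suc k)"
      unfolding mem_parcs_subdivided_graph_iff by blast
    with f_path w'_step show ?thesis by simp
  qed
  ultimately have "graph_hom (subdivided_graph t G) H f" unfolding graph_hom_def by blast
  then show ?thesis by blast
qed

text \<open>Restriction to the original vertices and extension along walks replace the subdivision
  of \<open>G\<close> by a relation power on \<open>H\<close>, which can be computed for Kneser
  graphs alone.\<close>

lemma ex_graph_hom_subdivided_iff:
  assumes "pair_bidirected_digraph G" "pair_bidirected_digraph H" "0 < t"
  shows "(\<exists>f. graph_hom (subdivided_graph t G) H f) \<longleftrightarrow>
    (\<exists>g \<in> funcset (pverts G) (pverts H). \<forall>(u, v) \<in> parcs G. (g u, g v) \<in> parcs H ^^ t)"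
proof
  assume "\<exists>f. graph_hom (subdivided_graph t G) H f"
  then obtain f where f: "graph_hom (subdivided_graph t G) H f" ..
  then have "f \<circ> Inl \<in> funcset (pverts G) (pverts H)"
    unfolding graph_hom_def subdivided_graph_def by auto
  with graph_hom_subdivided_walk[OF f _ assms(3)]
  show "\<exists>g \<in> funcset (pverts G) (pverts H). \<forall>(u, v) \<in> parcs G. (g u, g v) \<in> parcs H ^^ t"
    by (intro bexI[of _ "f \<circ> Inl"]) auto
next
  assume "\<exists>g \<in> funcset (pverts G) (pverts H). \<forall>(u, v) \<in> parcs G. (g u, g v) \<in> parcs H ^^ t"
  with graph_hom_subdividedI[OF assms] show "\<exists>f. graph_hom (subdivided_graph t G) H f" by blast
qed

section \<open>Walks in Kneser graphs\<close>

lemma mem_pverts_kneser_graph_iff: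
  "A \<in> pverts (kneser_graph m n) \<longleftrightarrow> A \<subseteq> {1..m} \<and> card A = n"
  by (simp add: kneser_graph_def)

lemma mem_parcs_kneser_graph_iff:
  "(A, B) \<in> parcs (kneser_graph m n) \<longleftrightarrow>
    A \<in> pverts (kneser_graph m n) \<and> B \<in> pverts (kneser_graph m n) \<and> A \<inter> B = {}"
  by (auto simp: kneser_graph_def)

text \<open>A walk of length 0 relates every set to itself, vertex or not, hence the positive
  length.\<close>

lemma kneser_graph_walk_ends:
  assumes "(A, B) \<in> parcs (kneser_graph m n) ^^ k" "0 < k"
  shows "A \<in> pverts (kneser_graph m n)" "B \<in> pverts (kneser_graph m n)"
proof -
  obtain k' where k': "k = Suc k'" using assms(2) gr0_implies_Suc by blast
  show "B \<in> pverts (kneser_graph m n)"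
    using assms(1) unfolding k' by (auto simp: mem_parcs_kneser_graph_iff)
  show "A \<in> pverts (kneser_graph m n)"
    \<comment> \<open>\<open>relpow.simps\<close> splits off the last step; commuting brings a step
      to the front, where \<open>A\<close> is its tail.\<close>
    using assms(1) unfolding k' relpow_commute[symmetric] relpow.simps
    by (auto simp: mem_parcs_kneser_graph_iff)
qed

lemma card_Diff_commute:
  assumes "finite A" "finite B" "card A = card B"
  shows "card (A - B) = card (B - A)"
  using assms card_Diff_subset_Int[of A B] card_Diff_subset_Int[of B A] by (simp add: Int_commute)

text \<open>For finite sets of equal size \<open>card (A - B)\<close> is half the size of the
  symmetric difference, hence a distance; this is its triangle inequality.\<close>

lemma card_Diff_triangle:
  assumes "finite A" "finite B"
  shows "card (A - C) \<le> card (A - B) + card (B - C)"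
proof -
  have "card (A - C) \<le> card ((A - B) \<union> (B - C))" using assms by (intro card_mono) auto
  also have "\<dots> \<le> card (A - B) + card (B - C)" by (rule card_Un_le)
  finally show ?thesis .
qed

text \<open>A common neighbour is an \<open>n\<close>-set in the complement of
  \<open>A \<union> B\<close>, and that complement has \<open>n + i - card (A - B)\<close>
  elements.\<close>

lemma kneser_graph_two_steps_iff:
  assumes A: "A \<in> pverts (kneser_graph (2 * n + i) n)"
    and B: "B \<in> pverts (kneser_graph (2 * n + i) n)"
  shows "(A, B) \<in> parcs (kneser_graph (2 * n + i) n) ^^ 2 \<longleftrightarrow> card (A - B) \<le> i"
proof -
  let ?X = "{1..2 * n + i}"
  have fin: "finite A" "finite B" and sub: "A \<subseteq> ?X" "B \<subseteq> ?X" and cards: "card A = n" "card B = n"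
    using A B finite_subset unfolding mem_pverts_kneser_graph_iff by auto
  have Un: "card (A \<union> B) = n + card (A - B)"
    using card_Un_disjoint[of B "A - B"] fin cards by (simp add: Un_commute)
  have compl: "card (?X - (A \<union> B)) = 2 * n + i - (n + card (A - B))"
    using sub card_Diff_subset[of "A \<union> B" ?X] fin Un by simp
  \<comment> \<open>This keeps the subtraction in \<open>compl\<close> from being truncated.\<close>
  have "n + card (A - B) \<le> 2 * n + i"
    using Un card_mono[of ?X "A \<union> B"] sub by simp
  then have "n \<le> card (?X - (A \<union> B)) \<longleftrightarrow> card (A - B) \<le> i" using compl by auto
  moreover have "(A, B) \<in> parcs (kneser_graph (2 * n + i) n) ^^ 2 \<longleftrightarrow>
      (\<exists>E \<subseteq> ?X - (A \<union> B). card E = n)"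
  proof -
    have "(A, E) \<in> parcs (kneser_graph (2 * n + i) n) \<and> (E, B) \<in> parcs (kneser_graph (2 * n + i) n)
        \<longleftrightarrow> E \<subseteq> ?X - (A \<union> B) \<and> card E = n" for E
      using A B unfolding mem_parcs_kneser_graph_iff mem_pverts_kneser_graph_iff by blast
    then show ?thesis by (simp add: numeral_2_eq_2 relcomp_unfold)
  qed
  moreover have "(\<exists>E \<subseteq> ?X - (A \<union> B). card E = n) \<longleftrightarrow> n \<le> card (?X - (A \<union> B))"
    by (meson card_mono finite_Diff finite_atLeastAtMost obtain_subset_with_card_n)
  ultimately show ?thesis by blast
qed

text \<open>Each pair of steps covers distance at most \<open>i\<close>. The triangle inequality
  bounds the total, and exchanging elements greedily attains it.\<close>

lemma kneser_graph_even_walk_iff: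
  assumes "A \<in> pverts (kneser_graph (2 * n + i) n)" "C \<in> pverts (kneser_graph (2 * n + i) n)"
  shows "(A, C) \<in> parcs (kneser_graph (2 * n + i) n) ^^ (2 * s) \<longleftrightarrow> card (A - C) \<le> i * s"
  using assms
proof (induction s arbitrary: A)
  case 0
  have "finite A" "finite C" "card A = card C"
    using 0 finite_subset unfolding mem_pverts_kneser_graph_iff by auto
  then have "A - C = {} \<longleftrightarrow> A = C" using card_subset_eq by blast
  with \<open>finite A\<close> show ?case by auto
next
  case (Suc s)
  let ?K = "kneser_graph (2 * n + i) n"
  have fin: "finite A" "finite C" and sub: "A \<subseteq> {1..2 * n + i}" "C \<subseteq> {1..2 * n + i}"
    and cards: "card A = n" "card C = n"
    using Suc.prems finite_subset unfolding mem_pverts_kneser_graph_iff by auto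
  have walk_split: "(A, C) \<in> parcs ?K ^^ (2 * Suc s) \<longleftrightarrow>
      (\<exists>D. (A, D) \<in> parcs ?K ^^ 2 \<and> (D, C) \<in> parcs ?K ^^ (2 * s))"
    using relpow_add[of 2 "2 * s" "parcs ?K"] by auto
  show ?case
  proof
    assume "(A, C) \<in> parcs ?K ^^ (2 * Suc s)"
    then obtain D where D: "(A, D) \<in> parcs ?K ^^ 2" "(D, C) \<in> parcs ?K ^^ (2 * s)"
      using walk_split by blast
    have DK: "D \<in> pverts ?K" using kneser_graph_walk_ends(2)[OF D(1)] by simp
    then have "finite D" using finite_subset unfolding mem_pverts_kneser_graph_iff by auto
    moreover have "card (A - D) \<le> i"
      using D(1) DK Suc.prems kneser_graph_two_steps_iff by blast
    moreover have "card (D - C) \<le> i * s" using Suc.IH[OF DK Suc.prems(2)] D(2) by blast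
    ultimately show "card (A - C) \<le> i * Suc s"
      using card_Diff_triangle[of A D C] fin by simp
  next
    assume le: "card (A - C) \<le> i * Suc s"
    \<comment> \<open>As many elements as two steps allow are exchanged: \<open>P\<close> leaves
      \<open>A\<close>, and \<open>Q\<close> enters from \<open>C\<close>.\<close>
    define j where "j = min i (card (A - C))"
    have j: "j \<le> card (A - C)" "j \<le> card (C - A)"
      using card_Diff_commute[of A C] fin cards by (simp_all add: j_def)
    obtain P where P: "P \<subseteq> A - C" "card P = j" using j(1) by (rule obtain_subset_with_card_n)
    obtain Q where Q: "Q \<subseteq> C - A" "card Q = j" using j(2) by (rule obtain_subset_with_card_n)
    have finPQ: "finite P" "finite Q" using P Q fin finite_subset by blast+
    define D where "D = (A - P) \<union> Q"
    have "card (A - P) = n - j" using P fin cards finPQ card_Diff_subset[of P A] by auto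
    moreover have "(A - P) \<inter> Q = {}" using Q by auto
    moreover have "j \<le> n" using card_mono[of A P] P fin cards by auto
    ultimately have "card D = n"
      unfolding D_def using card_Un_disjoint[of "A - P" Q] fin finPQ Q by simp
    then have DK: "D \<in> pverts ?K"
      using sub Q unfolding mem_pverts_kneser_graph_iff D_def by auto
    have "A - D = P" unfolding D_def using P Q by auto
    then have "card (A - D) \<le> i" using P by (simp add: j_def)
    then have "(A, D) \<in> parcs ?K ^^ 2" using DK Suc.prems kneser_graph_two_steps_iff by blast
    moreover have "D - C = (A - C) - P" unfolding D_def using P Q by auto
    then have "card (D - C) = card (A - C) - j" using P finPQ card_Diff_subset by metis
    \<comment> \<open>Either \<open>j = i\<close>, and the bound drops by \<open>i\<close>, or the
      exchange is complete and nothing remains.\<close>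
    then have "card (D - C) \<le> i * s" using le by (auto simp: j_def)
    then have "(D, C) \<in> parcs ?K ^^ (2 * s)" using Suc.IH[OF DK Suc.prems(2)] by blast
    ultimately show "(A, C) \<in> parcs ?K ^^ (2 * Suc s)" using walk_split by blast
  qed
qed

text \<open>The last step to \<open>B\<close> starts at some \<open>C\<close> disjoint from
  \<open>B\<close>, and reaching \<open>C\<close> from \<open>A\<close> in \<open>2 * s\<close>
  steps means only that \<open>C\<close> meets \<open>A\<close>. Such a \<open>C\<close> exists
  exactly when \<open>A\<close> has an element outside \<open>B\<close>.\<close>

lemma kneser_graph_odd_walk_iff:
  assumes A: "A \<in> pverts (kneser_graph (2 * n + i) n)"
    and B: "B \<in> pverts (kneser_graph (2 * n + i) n)"
    and "0 < n" and "i * s = n - 1"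
  shows "(A, B) \<in> parcs (kneser_graph (2 * n + i) n) ^^ (2 * s + 1) \<longleftrightarrow> A \<noteq> B"
proof -
  let ?K = "kneser_graph (2 * n + i) n" and ?X = "{1..2 * n + i}"
  have fin: "finite A" "finite B" and sub: "A \<subseteq> ?X" "B \<subseteq> ?X" and cards: "card A = n" "card B = n"
    using A B finite_subset unfolding mem_pverts_kneser_graph_iff by auto
  have walk_split: "(A, B) \<in> parcs ?K ^^ (2 * s + 1) \<longleftrightarrow>
      (\<exists>C \<in> pverts ?K. card (A - C) < n \<and> C \<inter> B = {})"
  proof -
    have "(A, B) \<in> parcs ?K ^^ (2 * s + 1) \<longleftrightarrow>
        (\<exists>C. (A, C) \<in> parcs ?K ^^ (2 * s) \<and> (C, B) \<in> parcs ?K)" by auto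
    also have "\<dots> \<longleftrightarrow> (\<exists>C \<in> pverts ?K. (A, C) \<in> parcs ?K ^^ (2 * s) \<and> C \<inter> B = {})"
      using B by (auto simp: mem_parcs_kneser_graph_iff)
    also have "\<dots> \<longleftrightarrow> (\<exists>C \<in> pverts ?K. card (A - C) \<le> i * s \<and> C \<inter> B = {})"
      using kneser_graph_even_walk_iff[OF A] by blast
    finally show ?thesis using assms(3,4) by (auto simp: less_eq_Suc_le le_diff_conv2)
  qed
  show ?thesis
  proof
    assume "(A, B) \<in> parcs ?K ^^ (2 * s + 1)"
    then obtain C where "card (A - C) < n" "C \<inter> B = {}" using walk_split by blast
    \<comment> \<open>If \<open>A = B\<close>, then \<open>C\<close> misses \<open>A\<close>, so
      \<open>A - C\<close> is all of \<open>A\<close> and has \<open>n\<close> elements.\<close>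
    then show "A \<noteq> B" using cards by (metis Diff_triv Int_commute less_irrefl)
  next
    assume "A \<noteq> B"
    \<comment> \<open>The complement of \<open>B\<close> has room for an \<open>n\<close>-set
      containing \<open>A - B\<close>.\<close>
    have "card (?X - B) = n + i" using sub fin cards card_Diff_subset[of B ?X] by simp
    moreover have "card (A - B) \<le> n" using cards fin card_mono[of A "A - B"] by auto
    moreover have "A - B \<subseteq> ?X - B" using sub by auto
    ultimately obtain C where C: "A - B \<subseteq> C" "C \<subseteq> ?X - B" "card C = n"
      using exists_subset_between[of "A - B" n "?X - B"] by auto
    \<comment> \<open>Distinct sets of equal finite size are not nested, so \<open>C\<close>
      contains an element of \<open>A\<close>.\<close>
    have "A - B \<noteq> {}" using \<open>A \<noteq> B\<close> cards card_subset_eq[OF fin(2), of A] by auto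
    then have "A - C \<subset> A" using C by blast
    then have "card (A - C) < n" using psubset_card_mono[OF fin(1)] cards by auto
    moreover have "C \<in> pverts ?K" "C \<inter> B = {}"
      using C unfolding mem_pverts_kneser_graph_iff by auto
    ultimately show "(A, B) \<in> parcs ?K ^^ (2 * s + 1)" using walk_split by blast
  qed
qed

theorem theorem4:
  fixes G :: "'a pair_pre_digraph" and i n s :: nat
  assumes "pair_bidirected_digraph G"
    and "\<not> bipartite G"
    and "i > 0" and "n > 0" and "s > 0"
    and "i * s = n - 1"
  shows "multichromatic_number n (subdivided_graph (2 * s + 1) G) \<le> enat (2 * n + i)
     \<longleftrightarrow> chromatic_number G \<le> enat ((2 * n + i) choose n)"
proof -
  interpret pair_bidirected_digraph G by (fact assms(1))
  let ?K = "kneser_graph (2 * n + i) n"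
  have K: "pverts ?K = {A. A \<subseteq> {1..2 * n + i} \<and> card A = n}" by (simp add: kneser_graph_def)
  have cardK: "card (pverts ?K) = (2 * n + i) choose n" unfolding K by (simp add: n_subsets)
  have finK: "finite (pverts ?K)" unfolding K by simp
  have "multichromatic_number n (subdivided_graph (2 * s + 1) G) \<le> enat (2 * n + i) \<longleftrightarrow>
      (\<exists>g \<in> funcset (pverts G) (pverts ?K). \<forall>(u, v) \<in> parcs G. (g u, g v) \<in> parcs ?K ^^ (2 * s + 1))"
    unfolding multichromatic_number_le_iff[OF le_add1]
    by (rule ex_graph_hom_subdivided_iff[OF assms(1) pair_bidirected_digraph_kneser_graph[OF assms(4)]])
      simp
  \<comment> \<open>For walks of length \<open>2 * s + 1\<close> the condition on \<open>g\<close>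
    is mere inequality along arcs: a proper colouring whose colours are the vertices of
    \<open>?K\<close>.\<close>
  also have "\<dots> \<longleftrightarrow> (\<exists>g \<in> funcset (pverts G) (pverts ?K). \<forall>(u, v) \<in> parcs G. g u \<noteq> g v)"
  proof (rule bex_cong[OF refl])
    fix g assume g: "g \<in> funcset (pverts G) (pverts ?K)"
    have "(g u, g v) \<in> parcs ?K ^^ (2 * s + 1) \<longleftrightarrow> g u \<noteq> g v" if "(u, v) \<in> parcs G" for u v
      using g in_arcsD1[OF that] in_arcsD2[OF that] assms(4,6)
      by (intro kneser_graph_odd_walk_iff) auto
    then show "(\<forall>(u, v) \<in> parcs G. (g u, g v) \<in> parcs ?K ^^ (2 * s + 1)) \<longleftrightarrow>
        (\<forall>(u, v) \<in> parcs G. g u \<noteq> g v)" by blast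
  qed
  also have "\<dots> \<longleftrightarrow> chromatic_number G \<le> enat ((2 * n + i) choose n)"
    using proper_colouring_iff_distinguishing_map[OF pair_wf_digraph_axioms finK] cardK
    by (simp add: chromatic_number_le_iff)
  finally show ?thesis .
qed

end
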